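(* Let $s\ge 0$ be an integer and let $\psi_0,\dots,\psi_s:[0,1]\to\mathbb R$ be a unisolvent family of bounded continuous functions. Let $0\le p_0<p_1<\dots<p_s=1$ be fixed. For each integer $n\ge 1$ let $A=A^{(n)}\in\mathbb R^{(s+1)\times(n+1)}$ be the matrix with entries $$A_{ij}=\mathbb P\big(\mathrm{Binomial}(n,p_i)=j\big),\qquad 0\le i\le s,\ 0\le j\le n,$$ and let $\Psi=\Psi^{(n)}\in\mathbb R^{(n+1)\times(s+1)}$ be the matrix with entries $\Psi_{ij}=\psi_j\left(\tfrac{i}{n}\right)$, $0\le i\le n$, $0\le j\le s$ (so that $e=\Psi\xi$ expresses $e_i=\xi_0\psi_0(\tfrac in)+\dots+\xi_s\psi_s(\tfrac in)$ for a coefficient vector $\xi\in\mathbb R^{s+1}$). Then $A\Psi$ is invertible as $n\to\infty$, i.e. $A^{(n)}\Psi^{(n)}$ is an invertible $(s+1)\times(s+1)$ matrix for all sufficiently large $n$.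
   Context: A family of functions $\psi_0,\dots,\psi_s$ on $[0,1]$ is unisolvent if for every choice of $s+1$ pairwise distinct points $t_0,\dots,t_s\in[0,1]$ the matrix $(\psi_j(t_i))_{0\le i,j\le s}$ is invertible. $\mathrm{Binomial}(n,p)$ denotes a binomial random variable with $n$ trials and success probability $p$. *)

theory Defs
  imports "HOL-Probability.Probability_Mass_Function" "Jordan_Normal_Form.Matrix"
begin

text \<open>The functions are extended arbitrarily outside the unit interval and, as a family,
  beyond the index \<open>s\<close>; only \<open>\<psi> j x\<close> with \<open>j \<le> s\<close> and \<open>0 \<le> x \<le> 1\<close> matters.\<close>

definition unisolvent :: "nat \<Rightarrow> (nat \<Rightarrow> real \<Rightarrow> real) \<Rightarrow> bool" where
  "unisolvent s \<psi> \<longleftrightarrow>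
     (\<forall>t :: nat \<Rightarrow> real. t ` {..s} \<subseteq> {0..1} \<longrightarrow> inj_on t {..s} \<longrightarrow>
        invertible_mat (mat (s + 1) (s + 1) (\<lambda>(i, j). \<psi> j (t i))))"

definition binom_mat :: "nat \<Rightarrow> (nat \<Rightarrow> real) \<Rightarrow> nat \<Rightarrow> real mat" where
  "binom_mat s p n = mat (s + 1) (n + 1) (\<lambda>(i, j). pmf (binomial_pmf n (p i)) j)"

definition sample_mat :: "nat \<Rightarrow> (nat \<Rightarrow> real \<Rightarrow> real) \<Rightarrow> nat \<Rightarrow> real mat" where
  "sample_mat s \<psi> n = mat (n + 1) (s + 1) (\<lambda>(i, j). \<psi> j (real i / real n))"

end

theory Submission
  imports Defs "HOL-Analysis.Weierstrass_Theorems" "Jordan_Normal_Form.Determinant"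
begin

text \<open>The \<open>(i, j)\<close> entry of \<open>A \<Psi>\<close> is the \<open>n\<close>-th Bernstein polynomial of \<open>\<psi> j\<close> at \<open>p i\<close>,
  which tends to \<open>\<psi> j (p i)\<close>. Hence \<open>det (A \<Psi>)\<close> tends to the determinant of the
  collocation matrix at the nodes \<open>p i\<close>, which is nonzero by unisolvence.\<close>

lemma invertible_mat_iff_det:
  fixes A :: "'a :: field mat"
  assumes A: "A \<in> carrier_mat n n"
  shows "invertible_mat A \<longleftrightarrow> det A \<noteq> 0"
proof
  assume "invertible_mat A"
  then obtain B where AB: "A * B = 1\<^sub>m n" and BA: "B * A = 1\<^sub>m (dim_row B)"
    using A by (auto simp: invertible_mat_def inverts_mat_def)
  \<comment> \<open>\<open>invertible_mat\<close> does not fix the shape of the inverse, so it is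
    read off from the columns of the two products.\<close>
  have "dim_col B = n" "dim_row B = n"
    using arg_cong[OF AB, of dim_col] arg_cong[OF BA, of dim_col] A by auto
  then have "B \<in> carrier_mat n n"
    by auto
  from det_mult[OF A this] AB show "det A \<noteq> 0"
    by auto
next
  assume "det A \<noteq> 0"
  \<comment> \<open>The \<open>()\<close> fills the irrelevant record extension of
    \<open>ring_mat\<close>.\<close>
  from det_non_zero_imp_unit[OF A this, of "()"]
  obtain B where "B \<in> carrier_mat n n" "A * B = 1\<^sub>m n" "B * A = 1\<^sub>m n"
    by (auto simp: Units_def ring_mat_def)
  with A show "invertible_mat A"
    by (auto simp: invertible_mat_def inverts_mat_def)
qed

text \<open>By the Leibniz formula the determinant is a polynomial in the entries, hence continuous
  in them.\<close>

lemma tendsto_det: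
  fixes A :: "'b \<Rightarrow> 'a :: real_normed_field mat"
  assumes A: "\<And>x. A x \<in> carrier_mat n n" and B: "B \<in> carrier_mat n n"
    and lim: "\<And>i j. i < n \<Longrightarrow> j < n \<Longrightarrow> ((\<lambda>x. A x $$ (i, j)) \<longlongrightarrow> B $$ (i, j)) F"
  shows "((\<lambda>x. det (A x)) \<longlongrightarrow> det B) F"
  unfolding det_def'[OF A] det_def'[OF B]
  by (intro tendsto_sum tendsto_mult tendsto_const tendsto_prod lim)
    (auto dest: permutes_in_image)

text \<open>Bernstein's proof of the Weierstrass theorem gives uniform convergence on the unit
  interval; it is read here at a single point.\<close>

lemma tendsto_Bernstein:
  fixes f :: "real \<Rightarrow> real"
  assumes "continuous_on {0..1} f" "x \<in> {0..1}"
  shows "(\<lambda>n. \<Sum>k\<le>n. f (k / n) * Bernstein n k x) \<longlonglongrightarrow> f x"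
proof (rule LIMSEQ_I)
  fix e :: real
  assume "0 < e"
  from Bernstein_Weierstrass[OF assms(1) this] assms(2)
  show "\<exists>N. \<forall>n\<ge>N. norm ((\<Sum>k\<le>n. f (k / n) * Bernstein n k x) - f x) < e"
    by (metis abs_minus_commute real_norm_def)
qed

text \<open>For a success probability in the unit interval, the binomial weight of \<open>k\<close>
  is the Bernstein basis polynomial at that probability.\<close>

lemma binom_mat_times_sample_mat_index:
  assumes "i \<le> s" "j \<le> s" "p i \<in> {0..1}"
  shows "(binom_mat s p n * sample_mat s \<psi> n) $$ (i, j)
    = (\<Sum>k\<le>n. \<psi> j (k / n) * Bernstein n k (p i))"
proof -
  have "(binom_mat s p n * sample_mat s \<psi> n) $$ (i, j)
      = (\<Sum>k<Suc n. pmf (binomial_pmf n (p i)) k * \<psi> j (k / n))"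
    using assms by (auto simp: binom_mat_def sample_mat_def scalar_prod_def atLeast0LessThan
        simp del: sum.lessThan_Suc)
  also have "\<dots> = (\<Sum>k\<le>n. \<psi> j (k / n) * Bernstein n k (p i))"
    using assms by (auto simp: lessThan_Suc_atMost Bernstein_def mult_ac intro!: sum.cong)
  finally show ?thesis .
qed

theorem theorem5p1:
  fixes s :: nat and \<psi> :: "nat \<Rightarrow> real \<Rightarrow> real" and p :: "nat \<Rightarrow> real"
  assumes "unisolvent s \<psi>"
    and "\<And>j. j \<le> s \<Longrightarrow> continuous_on {0..1} (\<psi> j)"
    and "\<And>j. j \<le> s \<Longrightarrow> bounded (\<psi> j ` {0..1})"
    and "0 \<le> p 0" and "strict_mono_on {..s} p" and "p s = 1"
  shows "\<forall>\<^sub>F n in sequentially. invertible_mat (binom_mat s p n * sample_mat s \<psi> n)"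
proof -
  define M where "M n = binom_mat s p n * sample_mat s \<psi> n" for n
  define B where "B = mat (s + 1) (s + 1) (\<lambda>(i, j). \<psi> j (p i))"
  have M: "M n \<in> carrier_mat (s + 1) (s + 1)" for n
    by (auto simp: M_def binom_mat_def sample_mat_def)
  have B: "B \<in> carrier_mat (s + 1) (s + 1)"
    by (simp add: B_def)
  \<comment> \<open>Weak monotonicity lets \<open>i\<close> be compared with \<open>0\<close> and
    \<open>s\<close> even when it equals one of them.\<close>
  have mono: "mono_on {..s} p"
    using assms(5) by (rule strict_mono_on_imp_mono_on)
  have p: "p i \<in> {0..1}" if "i \<le> s" for i
    using monotone_onD[OF mono, of 0 i] monotone_onD[OF mono, of i s] that assms(4,6) by auto
  have "inj_on p {..s}"
    using assms(5) by (rule strict_mono_on_imp_inj_on)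
  moreover have "p ` {..s} \<subseteq> {0..1}"
    using p by blast
  \<comment> \<open>Unisolvence is applied with the success probabilities themselves as
    nodes.\<close>
  ultimately have "det B \<noteq> 0"
    using assms(1) invertible_mat_iff_det[OF B] by (auto simp: unisolvent_def B_def)
  moreover have "(\<lambda>n. det (M n)) \<longlonglongrightarrow> det B"
  proof (rule tendsto_det[OF M B])
    fix i j
    assume "i < s + 1" "j < s + 1"
    then have ij: "i \<le> s" "j \<le> s"
      by auto
    then have "B $$ (i, j) = \<psi> j (p i)"
      by (simp add: B_def)
    then show "(\<lambda>n. M n $$ (i, j)) \<longlonglongrightarrow> B $$ (i, j)"
      unfolding M_def binom_mat_times_sample_mat_index[where p = p, OF ij p[OF ij(1)]]
      using tendsto_Bernstein[OF assms(2)[OF ij(2)] p[OF ij(1)]] by simp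
  qed
  \<comment> \<open>A sequence with nonzero limit is eventually nonzero.\<close>
  ultimately have "\<forall>\<^sub>F n in sequentially. det (M n) \<noteq> 0"
    by (rule tendsto_imp_eventually_ne[rotated])
  then show ?thesis
    unfolding invertible_mat_iff_det[OF M] M_def[symmetric] .
qed

end
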